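(* For every integer $n\geq 2$ and every real number $c\in[1,\infty)$ there exists a symplectic embedding $\varphi:(0,1)^{2n}\to(0,1)^{2n-1}\times(0,c)$ such that for every $z\in\mathbb{R}^{2n-2}$ the following holds: (i) The section $\iota_z^{-1}\big(\varphi\big((0,1)^{2n}\big)\big)\subseteq\mathbb{R}^2$ has area at most $\frac1c$. (ii) The complement of this section in $\mathbb{R}^2$, i.e. $\mathbb{R}^2\setminus\iota_z^{-1}\big(\varphi\big((0,1)^{2n}\big)\big)$, is path-connected.
   Context: The standard coordinates on $\mathbb{R}^{2n}$ are denoted, in this order, by $q^1,p_1,\ldots,q^n,p_n$ (upper and lower indices, not powers). $\mathbb{R}^{2n}$ and its open subsets are equipped with the standard symplectic form $\omega_0:=\sum_{i=1}^n dq^i\wedge dp_i$. A symplectic embedding between open subsets of $\mathbb{R}^{2n}$ is a smooth embedding that pulls back $\omega_0$ to $\omega_0$. For $z\in\mathbb{R}^{2n-2}$ the map $\iota_z:\mathbb{R}^2\to\mathbb{R}^{2n}$ is defined by $\iota_z(y):=(y,z)$. Area means two-dimensional Lebesgue measure. *)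

theory Defs
  imports "HOL-Analysis.Analysis"
begin

(* The space R^(2n) is split as R^2 x R^(2n-2): the first factor carries (q^1, p_1), and the pairs
   (q^i, p_i) for i = 2, ..., n are indexed by a nonempty finite linearly ordered type 'm.  Thus
   n = CARD('m) + 1 is an arbitrary integer with n >= 2, and Max UNIV :: 'm is the index of
   (q^n, p_n). *)

type_synonym plane = "real \<times> real"
type_synonym 'm rest_space = "plane ^ 'm"
type_synonym 'm phase_space = "plane \<times> 'm rest_space"

definition area_form :: "plane \<Rightarrow> plane \<Rightarrow> real" where
  "area_form v w = fst v * snd w - snd v * fst w"

definition omega0 :: "'m::finite phase_space \<Rightarrow> 'm phase_space \<Rightarrow> real" where
  "omega0 v w = area_form (fst v) (fst w) + (\<Sum>i\<in>UNIV. area_form (snd v $ i) (snd w $ i))"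

(* Intended for open S only, since the derivatives are taken at (at x), not within S. *)
fun Ck_on :: "nat \<Rightarrow> 'a::real_normed_vector set \<Rightarrow> ('a \<Rightarrow> 'b::real_normed_vector) \<Rightarrow> bool" where
  "Ck_on 0 S f \<longleftrightarrow> continuous_on S f"
| "Ck_on (Suc k) S f \<longleftrightarrow>
     (\<forall>x\<in>S. f differentiable (at x)) \<and>
     (\<forall>v. Ck_on k S (\<lambda>x. frechet_derivative f (at x) v))"

definition smooth_on :: "'a::real_normed_vector set \<Rightarrow> ('a \<Rightarrow> 'b::real_normed_vector) \<Rightarrow> bool" where
  "smooth_on S f \<longleftrightarrow> (\<forall>k. Ck_on k S f)"

definition smooth_embedding ::
  "'a::real_normed_vector set \<Rightarrow> 'b::real_normed_vector set \<Rightarrow> ('a \<Rightarrow> 'b) \<Rightarrow> bool" where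
  "smooth_embedding U V f \<longleftrightarrow>
     open U \<and> open V \<and> f ` U \<subseteq> V \<and>
     smooth_on U f \<and>
     (\<forall>x\<in>U. inj (frechet_derivative f (at x))) \<and>
     (\<exists>g. homeomorphism U (f ` U) f g)"

definition symplectic_embedding ::
  "'m::finite phase_space set \<Rightarrow> 'm phase_space set \<Rightarrow> ('m phase_space \<Rightarrow> 'm phase_space) \<Rightarrow> bool" where
  "symplectic_embedding U V f \<longleftrightarrow>
     smooth_embedding U V f \<and>
     (\<forall>x\<in>U. \<forall>v w. omega0 (frechet_derivative f (at x) v) (frechet_derivative f (at x) w) = omega0 v w)"

definition unit_cube :: "'m::finite phase_space set" where
  "unit_cube = {(y, z). y \<in> {0<..<1} \<times> {0<..<1} \<and> (\<forall>i. z $ i \<in> {0<..<1} \<times> {0<..<1})}"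

(* (0,1)^(2n-1) x (0,c): only the last coordinate p_n ranges over (0,c). *)
definition stretched_cube :: "real \<Rightarrow> 'm::{finite,linorder} phase_space set" where
  "stretched_cube c = {(y, z). y \<in> {0<..<1} \<times> {0<..<1} \<and>
     (\<forall>i. z $ i \<in> {0<..<1} \<times> {0<..<(if i = Max UNIV then c else 1)})}"

definition iota :: "'m::finite rest_space \<Rightarrow> plane \<Rightarrow> 'm phase_space" where
  "iota z y = (y, z)"

end

theory Submission
  imports Defs
begin

text \<open>
  The volume of the cube is 1 and the base of the sections has volume \<open>c\<close>, so the sections have
  average area \<open>1 / c\<close> and there is no room to spare: almost all of them must have area exactly
  \<open>1 / c\<close>. The construction achieves this by wrapping around circles.

  Only the planes of \<open>(q\<^sup>1, p\<^sub>1)\<close> and \<open>(q\<^sup>n, p\<^sub>n)\<close> matter. The linear symplectic shear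
  \<open>p\<^sub>1 \<mapsto> p\<^sub>1 + c * q\<^sup>n\<close>, \<open>p\<^sub>n \<mapsto> p\<^sub>n + c * q\<^sup>1\<close> spreads \<open>p\<^sub>n\<close> over an interval longer than \<open>c\<close>.
  If the new \<open>p\<^sub>n\<close> is read modulo \<open>c\<close> and the new \<open>p\<^sub>1\<close> modulo 1, the cube is embedded symplectically
  in a product of annuli of areas 1 and \<open>c\<close>. For a fixed point of the second annulus, \<open>q\<^sup>n\<close> is fixed
  and \<open>q\<^sup>1\<close> is confined, modulo 1, to an interval of length \<open>1 / c\<close>, while \<open>p\<^sub>1\<close> takes all values
  modulo 1 except \<open>c * q\<^sup>n\<close>. The section is thus a union of concentric annuli of total area \<open>1 / c\<close>,
  slit along a common ray; through the slit, the complement is path-connected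
  (\<open>section_cube_embedding\<close>, \<open>emeasure_slit_annuli_le\<close>, \<open>path_connected_Compl_slit_annuli\<close>).

  It remains to put an annulus of area 1 into the unit square by a smooth area-preserving
  embedding. Polar coordinates turn it into a punctured disc, and an explicit map
  straightens the disc into the square: each vertical chord is scaled to length 1, and the chords
  are spread out horizontally by the reciprocal factor (\<open>square_coords\<close>,
  \<open>square_coords_has_derivative\<close>). Stretching one side by \<open>c\<close> gives the rectangle.
\<close>

section \<open>Calculus of smooth maps\<close>

lemma Ck_on_cong:
  assumes "open S" "\<And>x. x \<in> S \<Longrightarrow> f x = g x" "Ck_on k S f"
  shows "Ck_on k S g"
  using assms
proof (induction k arbitrary: f g)
  case 0
  then show ?case by (simp cong: continuous_on_cong)
next
  case (Suc k)
  have *: "g differentiable at x \<and> frechet_derivative f (at x) = frechet_derivative g (at x)"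
    if x: "x \<in> S" for x
  proof -
    have "f differentiable at x"
      using Suc.prems x by simp
    then have "(f has_derivative frechet_derivative f (at x)) (at x)"
      using frechet_derivative_works by blast
    then have "(g has_derivative frechet_derivative f (at x)) (at x)"
      using Suc.prems x by (blast intro: has_derivative_transform_within_open)
    then show ?thesis
      using frechet_derivative_at differentiable_def by blast
  qed
  have "Ck_on k S (\<lambda>x. frechet_derivative g (at x) v)" for v
    using Suc.IH[of "\<lambda>x. frechet_derivative f (at x) v" "\<lambda>x. frechet_derivative g (at x) v"]
      * Suc.prems by simp
  with * show ?case by simp
qed

text \<open>Derivatives are usually known through an explicit formula on \<open>S\<close> rather than as
  \<open>frechet_derivative\<close>; the remaining closure properties all go through this rule.\<close>

lemma Ck_on_SucI:
  assumes "open S" "\<And>x. x \<in> S \<Longrightarrow> (f has_derivative f' x) (at x)"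
    and "\<And>v. Ck_on k S (\<lambda>x. f' x v)"
  shows "Ck_on (Suc k) S f"
proof -
  have "f' x = frechet_derivative f (at x)" if "x \<in> S" for x
    using assms(2)[OF that] by (rule frechet_derivative_at)
  then have "Ck_on k S (\<lambda>x. frechet_derivative f (at x) v)" for v
    using assms by (auto intro: Ck_on_cong[OF _ _ assms(3)])
  then show ?thesis
    using assms by (auto simp: differentiable_def)
qed

lemma Ck_on_SucD:
  assumes "Ck_on (Suc k) S f" "x \<in> S"
  shows "(f has_derivative frechet_derivative f (at x)) (at x)"
  using assms frechet_derivative_works by auto

lemma Ck_on_imp_continuous_on: "Ck_on k S f \<Longrightarrow> continuous_on S f"
  by (cases k) (auto intro!: differentiable_imp_continuous_on
      simp: differentiable_on_def differentiable_at_withinI)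

lemma Ck_on_Suc_imp_Ck_on: "Ck_on (Suc k) S f \<Longrightarrow> Ck_on k S f"
proof (induction k arbitrary: f)
  case 0
  then show ?case using Ck_on_imp_continuous_on[OF 0] by simp
next
  case (Suc k)
  then show ?case by (metis Ck_on.simps(2))
qed

lemma Ck_on_const: "open S \<Longrightarrow> Ck_on k S (\<lambda>x. a)"
proof (induction k arbitrary: a)
  case (Suc k)
  then show ?case by (intro Ck_on_SucI[where f' = "\<lambda>_ _. 0"]) auto
qed auto

lemma Ck_on_bounded_linear: "open S \<Longrightarrow> bounded_linear L \<Longrightarrow> Ck_on k S L"
  by (cases k) (auto simp del: Ck_on.simps(2) intro!: Ck_on_SucI[where f' = "\<lambda>_. L"] Ck_on_const
      bounded_linear_imp_has_derivative linear_continuous_on)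

lemma Ck_on_linear_compose:
  assumes "open S" "bounded_linear L" "Ck_on k S f"
  shows "Ck_on k S (\<lambda>x. L (f x))"
  using assms(3)
proof (induction k arbitrary: f)
  case 0
  then show ?case
    using assms(2) by (auto intro: bounded_linear.continuous_on)
next
  case (Suc k)
  show ?case
  proof (rule Ck_on_SucI[OF assms(1)])
    show "((\<lambda>x. L (f x)) has_derivative (\<lambda>v. L (frechet_derivative f (at x) v))) (at x)"
      if "x \<in> S" for x
      using bounded_linear.has_derivative[OF assms(2) Ck_on_SucD[OF Suc.prems that]] .
    show "Ck_on k S (\<lambda>x. L (frechet_derivative f (at x) v))" for v
      using Suc by auto
  qed
qed

lemma Ck_on_add:
  assumes "open S" "Ck_on k S f" "Ck_on k S g"
  shows "Ck_on k S (\<lambda>x. f x + g x)"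
  using assms(2,3)
proof (induction k arbitrary: f g)
  case 0
  then show ?case by (auto intro: continuous_on_add)
next
  case (Suc k)
  show ?case
  proof (rule Ck_on_SucI[OF assms(1)])
    show "((\<lambda>x. f x + g x) has_derivative
        (\<lambda>v. frechet_derivative f (at x) v + frechet_derivative g (at x) v)) (at x)"
      if "x \<in> S" for x
      using has_derivative_add[OF Ck_on_SucD[OF Suc.prems(1) that] Ck_on_SucD[OF Suc.prems(2) that]] .
    show "Ck_on k S (\<lambda>x. frechet_derivative f (at x) v + frechet_derivative g (at x) v)" for v
      using Suc by auto
  qed
qed

lemma Ck_on_mult:
  fixes f g :: "'a::real_normed_vector \<Rightarrow> real"
  assumes "open S" "Ck_on k S f" "Ck_on k S g"
  shows "Ck_on k S (\<lambda>x. f x * g x)"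
  using assms(2,3)
proof (induction k arbitrary: f g)
  case 0
  then show ?case by (auto intro: continuous_on_mult)
next
  case (Suc k)
  show ?case
  proof (rule Ck_on_SucI[OF assms(1)])
    show "((\<lambda>x. f x * g x) has_derivative
        (\<lambda>v. f x * frechet_derivative g (at x) v + frechet_derivative f (at x) v * g x)) (at x)"
      if "x \<in> S" for x
      using has_derivative_mult[OF Ck_on_SucD[OF Suc.prems(1) that] Ck_on_SucD[OF Suc.prems(2) that]] .
    show "Ck_on k S (\<lambda>x. f x * frechet_derivative g (at x) v + frechet_derivative f (at x) v * g x)" for v
      using Suc.prems Suc.prems[THEN Ck_on_Suc_imp_Ck_on]
      by (intro Ck_on_add assms Suc.IH) auto
  qed
qed

text \<open>Every directional derivative of \<open>h \<circ> g\<close> is a product of a derivative of \<open>h\<close>, again composed with \<open>g\<close>,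
  and a derivative of \<open>g\<close>; so the order of differentiability is carried over by induction.\<close>

lemma Ck_on_compose_real:
  fixes h :: "real \<Rightarrow> real" and g :: "'a::real_normed_vector \<Rightarrow> real"
  assumes "open S" "Ck_on k T h" "Ck_on k S g" "\<And>x. x \<in> S \<Longrightarrow> g x \<in> T"
  shows "Ck_on k S (\<lambda>x. h (g x))"
  using assms(2,3)
proof (induction k arbitrary: h)
  case 0
  then show ?case
    using assms(4) by (auto intro: continuous_on_compose2)
next
  case (Suc k)
  let ?h' = "\<lambda>y. frechet_derivative h (at y) 1"
  show ?case
  proof (rule Ck_on_SucI[OF assms(1)])
    fix x assume x: "x \<in> S"
    have h: "(h has_derivative frechet_derivative h (at (g x))) (at (g x))"
      using Ck_on_SucD[OF Suc.prems(1)] assms(4) x by blast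
    have "frechet_derivative h (at (g x)) = (\<lambda>r. ?h' (g x) * r)"
    proof
      show "frechet_derivative h (at (g x)) r = ?h' (g x) * r" for r
        using linear_scale[OF has_derivative_linear[OF h], of r 1] by simp
    qed
    from has_derivative_compose[OF Ck_on_SucD[OF Suc.prems(2) x] has_derivative_eq_rhs[OF h this]]
    show "((\<lambda>x. h (g x)) has_derivative (\<lambda>v. ?h' (g x) * frechet_derivative g (at x) v)) (at x)" .
  next
    have "Ck_on k T ?h'" "Ck_on k S (\<lambda>x. frechet_derivative g (at x) v)" for v
      using Suc.prems by simp_all
    then show "Ck_on k S (\<lambda>x. ?h' (g x) * frechet_derivative g (at x) v)" for v
      using Suc.IH[of ?h'] Ck_on_Suc_imp_Ck_on[OF Suc.prems(2)] by (intro Ck_on_mult assms(1))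
  qed
qed

lemma Ck_on_sum:
  assumes "open S" "\<And>i. i \<in> I \<Longrightarrow> Ck_on k S (f i)"
  shows "Ck_on k S (\<lambda>x. \<Sum>i\<in>I. f i x)"
  using assms(2)
  by (induction I rule: infinite_finite_induct) (auto intro: Ck_on_const Ck_on_add assms(1))

lemma Ck_on_Pair:
  assumes "open S" "Ck_on k S f" "Ck_on k S g"
  shows "Ck_on k S (\<lambda>x. (f x, g x))"
proof -
  have "Ck_on k S (\<lambda>x. (f x, 0) + (0, g x))"
    using assms by (intro Ck_on_add Ck_on_linear_compose[where L = "\<lambda>y. (y, 0)"]
        Ck_on_linear_compose[where L = "\<lambda>y. (0, y)"]) (auto intro!: bounded_linear_intros)
  then show ?thesis by simp
qed

lemma bounded_linear_axis: "bounded_linear (axis i :: 'a::real_normed_vector \<Rightarrow> 'a ^ 'n::finite)"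
proof (rule bounded_linear_intro[where K = 1])
  show "norm (axis i x) \<le> norm x * 1" for x :: 'a
    by (simp add: norm_vec_def L2_set_def axis_def if_distrib[of norm] if_distrib[of "\<lambda>r. r ^ 2"]
        sum.delta cong: if_cong)
qed (auto simp: axis_def vec_eq_iff)

lemma vec_lambda_eq_sum_axis: "(\<chi> i. f i) = (\<Sum>i\<in>UNIV. axis i (f i))"
  by (simp add: vec_eq_iff axis_def if_distrib if_distribR sum.delta cong: if_cong)

lemma Ck_on_vec_lambda:
  fixes f :: "'n::finite \<Rightarrow> 'a::real_normed_vector \<Rightarrow> 'b::real_normed_vector"
  assumes "open S" "\<And>i. Ck_on k S (f i)"
  shows "Ck_on k S (\<lambda>x. \<chi> i. f i x)"
  unfolding vec_lambda_eq_sum_axis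
  by (intro Ck_on_sum Ck_on_linear_compose[OF _ bounded_linear_axis] assms)

lemma has_derivative_vec_lambda:
  fixes f :: "'n::finite \<Rightarrow> 'a::real_normed_vector \<Rightarrow> 'b::real_normed_vector"
  assumes "\<And>i. (f i has_derivative f' i) F"
  shows "((\<lambda>x. \<chi> i. f i x) has_derivative (\<lambda>v. \<chi> i. f' i v)) F"
  unfolding vec_lambda_eq_sum_axis
  by (intro has_derivative_sum bounded_linear.has_derivative[OF bounded_linear_axis] assms)

lemma Ck_on_field_derivative:
  fixes h h' :: "real \<Rightarrow> real"
  assumes "open T" "\<And>y. y \<in> T \<Longrightarrow> (h has_real_derivative h' y) (at y)" "Ck_on k T h'"
  shows "Ck_on (Suc k) T h"
  using assms by (intro Ck_on_SucI[where f' = "\<lambda>y v. h' y * v"] Ck_on_mult Ck_on_const)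
    (auto simp: has_field_derivative_def)

text \<open>Sine and cosine are each other's derivatives up to sign, so neither induction closes alone.\<close>

lemma Ck_on_sin_cos: "Ck_on k UNIV (sin :: real \<Rightarrow> real) \<and> Ck_on k UNIV (cos :: real \<Rightarrow> real)"
proof (induction k)
  case 0
  then show ?case by (auto intro!: continuous_intros)
next
  case (Suc k)
  have "Ck_on k UNIV (\<lambda>x::real. -1 * sin x)"
    using Suc by (intro Ck_on_mult Ck_on_const) auto
  then have "Ck_on (Suc k) UNIV (cos :: real \<Rightarrow> real)"
    by (rule Ck_on_field_derivative[rotated -1]) (auto intro!: derivative_eq_intros)
  moreover have "Ck_on (Suc k) UNIV (sin :: real \<Rightarrow> real)"
    using Suc by (intro Ck_on_field_derivative[where h' = cos]) (auto intro!: derivative_eq_intros)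
  ultimately show ?case by blast
qed

lemma Ck_on_inverse: "Ck_on k {0<..} (inverse :: real \<Rightarrow> real)"
proof (induction k)
  case 0
  then show ?case by (auto intro!: continuous_intros)
next
  case (Suc k)
  then show ?case
    by (intro Ck_on_field_derivative[where h' = "\<lambda>x. -1 * (inverse x * inverse x)"]
        Ck_on_mult Ck_on_const) (auto intro!: derivative_eq_intros)
qed

text \<open>The derivative \<open>1 / (2 * sqrt x)\<close> is built from \<open>sqrt\<close> itself, which lets the induction
  over the order close on the half-line.\<close>

lemma Ck_on_sqrt: "Ck_on k {0<..} sqrt"
proof (induction k)
  case 0
  then show ?case by (auto intro!: continuous_intros)
next
  case (Suc k)
  then show ?case
    by (intro Ck_on_field_derivative[where h' = "\<lambda>x. inverse (sqrt x) * (1 / 2)"] Ck_on_mult Ck_on_const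
        Ck_on_compose_real[OF _ Ck_on_inverse]) (auto intro!: derivative_eq_intros)
qed

lemma Ck_on_arcsin: "Ck_on k {-1<..<1} arcsin"
proof (cases k)
  case 0
  then show ?thesis by (auto intro!: continuous_intros)
next
  case (Suc l)
  have pos: "1 + - 1 * (x * x) > 0" if "x \<in> {-1<..<1}" for x :: real
    using that abs_square_less_1[of x] by (auto simp: power2_eq_square abs_if split: if_splits)
  show ?thesis
    unfolding Suc
  proof (rule Ck_on_field_derivative)
    show "(arcsin has_real_derivative inverse (sqrt (1 + - 1 * (y * y)))) (at y)" if "y \<in> {-1<..<1}" for y
      using DERIV_arcsin[of y] that by (simp add: power2_eq_square)
    have "Ck_on l {-1<..<1} (\<lambda>x::real. x * x)"
      by (intro Ck_on_mult Ck_on_bounded_linear bounded_linear_ident) auto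
    then show "Ck_on l {-1<..<1} (\<lambda>y. inverse (sqrt (1 + - 1 * (y * y))))"
      using pos by (intro Ck_on_compose_real[OF _ Ck_on_inverse] Ck_on_compose_real[OF _ Ck_on_sqrt]
          Ck_on_add Ck_on_const Ck_on_mult Ck_on_bounded_linear[OF _ bounded_linear_ident]) auto
  qed auto
qed

section \<open>Area-preserving polar coordinates on the unit square\<close>

text \<open>Symplectic polar coordinates on the punctured unit disc: \<open>q\<close> is the squared radius and \<open>p\<close> the
  number of turns, so that \<open>ds \<and> dt = pi * dq \<and> dp\<close>.\<close>

definition disc_coords :: "plane \<Rightarrow> plane" where
  "disc_coords y = (sqrt (fst y) * cos (2 * pi * snd y), sqrt (fst y) * sin (2 * pi * snd y))"

text \<open>The fraction of the area of the unit disc that lies to the left of the chord with abscissa \<open>s\<close>.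
  Its derivative is proportional to the length of that chord.\<close>

definition cap_area :: "real \<Rightarrow> real" where
  "cap_area s = 1 / 2 + (s * sqrt (1 - s * s) + arcsin s) / pi"

text \<open>For increasing \<open>u\<close>, the map \<open>(s, t) \<mapsto> (u s, t / u' s)\<close> preserves area. Taking \<open>u'\<close>
  proportional to the length of the vertical chord at \<open>s\<close> makes all chords equally long, so that
  the disc becomes a rectangle. Here \<open>u = cap_area\<close>, and the second coordinate is moreover divided
  by \<open>pi\<close> and translated, so that the rectangle becomes the unit square and areas are divided by \<open>pi\<close>.\<close>

definition square_of_disc :: "plane \<Rightarrow> plane" where
  "square_of_disc x = (cap_area (fst x), 1 / 2 + snd x / (2 * sqrt (1 - fst x * fst x)))"

text \<open>The factors \<open>pi\<close> and \<open>1 / pi\<close> cancel: these are area-preserving coordinates, of period 1 in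
  \<open>p\<close>, on the open unit square without its center.\<close>

definition square_coords :: "plane \<Rightarrow> plane" where
  "square_coords y = square_of_disc (disc_coords y)"

abbreviation open_square :: "plane set" where
  "open_square \<equiv> {0<..<1} \<times> {0<..<1}"

abbreviation strip :: "plane set" where
  "strip \<equiv> {0<..<1} \<times> UNIV"

lemma one_minus_square_pos: "s \<in> {-1<..<1} \<Longrightarrow> 0 < 1 - s * s" for s :: real
  using abs_square_less_1[of s] by (auto simp: power2_eq_square abs_if split: if_splits)

lemma DERIV_cap_area:
  assumes "s \<in> {-1<..<1}"
  shows "(cap_area has_real_derivative 2 * sqrt (1 - s * s) / pi) (at s)"
proof -
  define w where "w = sqrt (1 - s * s)"
  have w: "w > 0" "w * w = 1 - s * s" "sqrt (1 - s\<^sup>2) = w"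
    using one_minus_square_pos[OF assms] by (simp_all add: w_def power2_eq_square)
  have "(cap_area has_real_derivative
      (w + s * (- (2 * s) * (inverse w / 2)) + inverse w) / pi) (at s)"
    unfolding cap_area_def using assms w(1) one_minus_square_pos[OF assms]
    by (auto intro!: derivative_eq_intros simp: w(3) simp flip: w_def)
  moreover have "w + s * (- (2 * s) * (inverse w / 2)) + inverse w = 2 * w"
  proof -
    have "w + s * (- (2 * s) * (inverse w / 2)) + inverse w = (w * w + (1 - s * s)) / w"
      using w(1) by (simp add: field_simps)
    also have "\<dots> = 2 * w"
      using w(1) by (simp flip: w(2))
    finally show ?thesis .
  qed
  ultimately show ?thesis
    by (simp only: w_def)
qed

lemma continuous_on_cap_area: "continuous_on {-1..1} cap_area"
  unfolding cap_area_def by (intro continuous_intros) auto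

lemma cap_area_minus_1: "cap_area (-1) = 0" and cap_area_1: "cap_area 1 = 1"
  by (simp_all add: cap_area_def)

lemma cap_area_less:
  assumes "-1 \<le> r" "r < s" "s \<le> 1"
  shows "cap_area r < cap_area s"
proof (rule DERIV_pos_imp_increasing_open[OF assms(2)])
  show "\<exists>y. (cap_area has_real_derivative y) (at x) \<and> y > 0" if "r < x" "x < s" for x
    using DERIV_cap_area[of x] one_minus_square_pos[of x] that assms by fastforce
  show "continuous_on {r..s} cap_area"
    using continuous_on_cap_area by (rule continuous_on_subset) (use assms in auto)
qed

lemma in_disc_imp_abs_less: "s\<^sup>2 + t\<^sup>2 < 1 \<Longrightarrow> s \<in> {-1<..<1}" for s t :: real
  using abs_square_less_1[of s] zero_le_power2[of t] by (auto simp del: zero_le_power2)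

lemma square_of_disc_in_open_square:
  assumes "(fst x)\<^sup>2 + (snd x)\<^sup>2 < 1"
  shows "square_of_disc x \<in> open_square"
proof -
  note s = in_disc_imp_abs_less[OF assms]
  define w where "w = sqrt (1 - fst x * fst x)"
  have w: "w > 0" "w * w = 1 - fst x * fst x"
    using one_minus_square_pos[OF s] by (simp_all add: w_def)
  have "\<bar>snd x\<bar> < w"
    by (rule power2_less_imp_less) (use w assms in \<open>auto simp: power2_eq_square\<close>)
  then have "-1 < snd x / w" "snd x / w < 1"
    using w(1) by (auto simp: field_simps)
  then show ?thesis
    using cap_area_less[of "-1" "fst x"] cap_area_less[of "fst x" 1] s
    by (auto simp: square_of_disc_def cap_area_minus_1 cap_area_1 simp flip: w_def)
qed

lemma inj_on_square_of_disc: "inj_on square_of_disc {x. (fst x)\<^sup>2 + (snd x)\<^sup>2 < 1}"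
proof (rule inj_onI, clarsimp)
  fix s t s' t'
  assume s: "s\<^sup>2 + t\<^sup>2 < 1" and s': "s'\<^sup>2 + t'\<^sup>2 < 1"
    and eq: "square_of_disc (s, t) = square_of_disc (s', t')"
  have "s = s'"
    using cap_area_less[of s s'] cap_area_less[of s' s] eq
      in_disc_imp_abs_less[OF s] in_disc_imp_abs_less[OF s']
    by (force simp: square_of_disc_def not_less_iff_gr_or_eq)
  then show "s = s' \<and> t = t'"
    using eq one_minus_square_pos[OF in_disc_imp_abs_less[OF s]] by (auto simp: square_of_disc_def)
qed

lemma open_square_subset_square_of_disc:
  "open_square \<subseteq> square_of_disc ` {x. (fst x)\<^sup>2 + (snd x)\<^sup>2 < 1}"
proof clarsimp
  fix a b :: real
  assume ab: "0 < a" "a < 1" "0 < b" "b < 1"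
  obtain s where s: "-1 \<le> s" "s \<le> 1" "cap_area s = a"
    using IVT'[of cap_area "-1" a 1] ab continuous_on_cap_area
    by (auto simp: cap_area_minus_1 cap_area_1)
  then have s': "s \<in> {-1<..<1}"
    using ab cap_area_1 cap_area_minus_1 by (auto simp: less_le)
  define w where "w = sqrt (1 - s * s)"
  have w: "w > 0" "w\<^sup>2 = 1 - s\<^sup>2"
    using one_minus_square_pos[OF s'] by (simp_all add: w_def power2_eq_square)
  have "(2 * b - 1)\<^sup>2 < 1"
    using ab abs_square_less_1[of "2 * b - 1"] by (auto simp: abs_if)
  then have "(2 * b - 1)\<^sup>2 * w\<^sup>2 < 1 * w\<^sup>2"
    using w(1) by (intro mult_strict_right_mono) auto
  then have "s\<^sup>2 + ((2 * b - 1) * w)\<^sup>2 < 1"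
    using w(2) by (simp add: power_mult_distrib)
  moreover have "square_of_disc (s, (2 * b - 1) * w) = (a, b)"
    using w(1) s by (simp add: square_of_disc_def field_simps flip: w_def)
  ultimately show "(a, b) \<in> square_of_disc ` {x. (fst x)\<^sup>2 + (snd x)\<^sup>2 < 1}"
    by (intro image_eqI[where x = "(s, (2 * b - 1) * w)"]) auto
qed

lemma sum_squares_disc_coords:
  "0 \<le> q \<Longrightarrow> (fst (disc_coords (q, p)))\<^sup>2 + (snd (disc_coords (q, p)))\<^sup>2 = q"
  by (simp add: disc_coords_def power_mult_distrib flip: distrib_left)

lemma square_coords_in_open_square: "y \<in> strip \<Longrightarrow> square_coords y \<in> open_square"
  unfolding square_coords_def
  using sum_squares_disc_coords[of "fst y" "snd y"] by (intro square_of_disc_in_open_square) auto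

lemma square_coords_periodic: "square_coords (q, p + of_int k) = square_coords (q, p)"
proof -
  have "2 * pi * (p + of_int k) = 2 * pi * p + 2 * pi * of_int k"
    by (simp add: algebra_simps)
  then have "cos (2 * pi * (p + of_int k)) = cos (2 * pi * p)"
    "sin (2 * pi * (p + of_int k)) = sin (2 * pi * p)"
    using sin_cos_eq_iff[of "2 * pi * (p + of_int k)" "2 * pi * p"] by metis+
  then show ?thesis
    by (simp add: square_coords_def disc_coords_def)
qed

text \<open>The value \<open>q = 0\<close> is included here, in order to separate the center of the square from the
  points with \<open>q > 0\<close>.\<close>

lemma square_coords_eqD_disc:
  assumes "square_coords (q, p) = square_coords (q', p')" "q \<in> {0..<1}" "q' \<in> {0..<1}"
  shows "disc_coords (q, p) = disc_coords (q', p')" and "q' = q"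
proof -
  show eq: "disc_coords (q, p) = disc_coords (q', p')"
    using inj_onD[OF inj_on_square_of_disc assms(1)[unfolded square_coords_def]] assms(2,3)
    by (simp add: sum_squares_disc_coords)
  then show "q' = q"
    using sum_squares_disc_coords[of q p] sum_squares_disc_coords[of q' p'] assms(2,3) by simp
qed

lemma square_coords_eqD:
  assumes "square_coords (q, p) = square_coords (q', p')" "q \<in> {0<..<1}" "q' \<in> {0<..<1}"
  obtains k :: int where "q' = q" "p' = p + k"
proof -
  have "disc_coords (q, p) = disc_coords (q', p')" and "q' = q"
    using square_coords_eqD_disc[OF assms(1)] assms(2,3) by simp_all
  then have "cos (2 * pi * p') = cos (2 * pi * p)" "sin (2 * pi * p') = sin (2 * pi * p)"
    using assms(2) by (auto simp: disc_coords_def)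
  then obtain k :: int where "2 * pi * p' = 2 * pi * p + 2 * pi * k"
    using sin_cos_eq_iff by blast
  then have "2 * pi * p' = 2 * pi * (p + k)"
    by (simp add: algebra_simps)
  then have "p' = p + k"
    by simp
  with \<open>q' = q\<close> show thesis
    using that by blast
qed

lemma square_coords_0: "square_coords (0, p) = (1 / 2, 1 / 2)"
  by (simp add: square_coords_def disc_coords_def square_of_disc_def cap_area_def)

lemma open_square_cases:
  assumes "y \<in> open_square"
  obtains "y = (1 / 2, 1 / 2)" | q p where "q \<in> {0<..<1}" "y = square_coords (q, p)"
proof -
  obtain x where x: "(fst x)\<^sup>2 + (snd x)\<^sup>2 < 1" "y = square_of_disc x"
    using open_square_subset_square_of_disc assms by auto
  define q where "q = (fst x)\<^sup>2 + (snd x)\<^sup>2"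
  show thesis
  proof (cases "q = 0")
    case True
    then have "x = 0"
      by (auto simp: q_def prod_eq_iff)
    then show thesis
      using x(2) that(1) by (simp add: square_of_disc_def cap_area_def)
  next
    case False
    then have q: "q > 0"
      by (metis q_def sum_power2_ge_zero less_le)
    have "(fst x / sqrt q)\<^sup>2 + (snd x / sqrt q)\<^sup>2 = q / q"
      using q by (simp add: power_divide flip: add_divide_distrib) (simp add: q_def)
    then have "(fst x / sqrt q)\<^sup>2 + (snd x / sqrt q)\<^sup>2 = 1"
      using q by simp
    then obtain \<theta> where "fst x / sqrt q = cos \<theta>" "snd x / sqrt q = sin \<theta>"
      using sincos_total_2pi by metis
    then have "x = disc_coords (q, \<theta> / (2 * pi))"
      using q by (auto simp: disc_coords_def prod_eq_iff field_simps)
    moreover have "q < 1"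
      using x(1) by (simp add: q_def)
    ultimately show thesis
      using that(2)[of q "\<theta> / (2 * pi)"] x(2) q by (simp add: square_coords_def)
  qed
qed

text \<open>A point of the unit circle is sent to the boundary of the square: to its top or bottom side if
  \<open>t\<close> is nonzero, and otherwise, because division by zero yields zero, to the midpoint of its left
  or right side.\<close>

lemma square_coords_1: "square_coords (1, p) \<notin> open_square"
proof -
  define s where "s = cos (2 * pi * p)"
  define t where "t = sin (2 * pi * p)"
  have st: "1 - s * s = t\<^sup>2"
    using sin_cos_squared_add[of "2 * pi * p"] by (simp add: s_def t_def power2_eq_square)
  have *: "square_coords (1, p) = (cap_area s, 1 / 2 + t / (2 * \<bar>t\<bar>))"
    by (simp add: square_coords_def square_of_disc_def disc_coords_def st flip: s_def t_def)
  show ?thesis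
  proof (cases "t = 0")
    case True
    then have "s = 1 \<or> s = -1"
      using st by (metis diff_eq_eq power2_eq_square power_zero_numeral square_eq_1_iff add_0)
    then show ?thesis
      using * by (auto simp: cap_area_1 cap_area_minus_1)
  next
    case False
    then show ?thesis
      using * by (auto simp: abs_if)
  qed
qed

text \<open>Although \<open>square_of_disc\<close> is not continuous on the closed disc, it is so along each closed radius:
  either the chord length stays away from zero, or the radius is horizontal and the quotient in
  the second coordinate vanishes identically.\<close>

lemma continuous_on_square_coords_ray: "continuous_on {0..1} (\<lambda>q. square_coords (q, p))"
proof -
  define s where "s = cos (2 * pi * p)"
  define t where "t = sin (2 * pi * p)"
  have st: "s * s + t * t = 1"
    by (simp add: s_def t_def flip: power2_eq_square)
  have "s * s \<le> 1"
    using st zero_le_square[of t] by linarith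
  have eq: "square_coords (q, p) = (cap_area (sqrt q * s),
      1 / 2 + sqrt q * t / (2 * sqrt (1 - q * (s * s))))" if "q \<in> {0..1}" for q
  proof -
    have "disc_coords (q, p) = (sqrt q * s, sqrt q * t)"
      by (simp add: disc_coords_def s_def t_def)
    moreover have "(sqrt q * s) * (sqrt q * s) = (sqrt q * sqrt q) * (s * s)"
      by (simp only: mult_ac)
    ultimately show ?thesis
      using that by (simp add: square_coords_def square_of_disc_def)
  qed
  have *: "continuous_on {0..1} (\<lambda>q. sqrt q * t / (2 * sqrt (1 - q * (s * s))))"
  proof (cases "t = 0")
    case False
    then have "s * s < 1"
      using st by (metis less_add_same_cancel1 not_real_square_gt_zero)
    have "q * (s * s) \<noteq> 1" if "q \<in> {0..1}" for q
      using that mult_left_le_one_le[of "s * s" q] \<open>s * s < 1\<close> by auto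
    then show ?thesis
      by (intro continuous_intros) auto
  qed simp
  have "continuous_on {0..1} (\<lambda>q. cap_area (sqrt q * s))"
  proof (rule continuous_on_compose2[OF continuous_on_cap_area])
    show "(\<lambda>q. sqrt q * s) ` {0..1} \<subseteq> {- 1..1}"
    proof clarify
      fix q :: real assume "q \<in> {0..1}"
      then have "(sqrt q * s)\<^sup>2 \<le> 1"
        using mult_le_one[of q "s\<^sup>2"] \<open>s * s \<le> 1\<close> by (simp add: power_mult_distrib flip: power2_eq_square)
      then show "sqrt q * s \<in> {- 1..1}"
        by (auto simp: abs_square_le_1 abs_le_iff)
    qed
  qed (intro continuous_intros)
  with * show ?thesis
    by (subst continuous_on_cong[OF refl eq]) (auto intro!: continuous_intros)
qed

lemma area_form_matrix:
  "area_form (a * fst v + b * snd v, c * fst v + d * snd v)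
     (a * fst w + b * snd w, c * fst w + d * snd w) = (a * d - b * c) * area_form v w"
  by (simp add: area_form_def algebra_simps)

text \<open>The Jacobian determinants of \<open>disc_coords\<close> and \<open>square_of_disc\<close> are \<open>pi\<close> and \<open>1 / pi\<close>.\<close>

lemma square_coords_has_derivative:
  assumes "y \<in> strip"
  shows "\<exists>D. (square_coords has_derivative D) (at y) \<and> (\<forall>v w. area_form (D v) (D w) = area_form v w)"
proof -
  obtain q p where y: "y = (q, p)" "0 < q" "q < 1"
    using assms by auto
  define r where "r = sqrt q"
  define C where "C = cos (2 * pi * p)"
  define S where "S = sin (2 * pi * p)"
  have r: "r > 0" and CS: "C * C + S * S = 1"
    using y by (simp_all add: r_def C_def S_def flip: power2_eq_square)
  define P where "P = (\<lambda>v :: plane. (C / (2 * r) * fst v + (- 2 * pi * r * S) * snd v,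
      S / (2 * r) * fst v + (2 * pi * r * C) * snd v))"
  have P: "(disc_coords has_derivative P) (at y)"
    unfolding disc_coords_def[abs_def] P_def
    using y(2) r by (auto intro!: derivative_eq_intros
        simp: y(1) fun_eq_iff divide_simps simp flip: r_def C_def S_def)
  have P_area: "area_form (P v) (P w) = pi * area_form v w" for v w
  proof -
    have "C / (2 * r) * (2 * pi * r * C) - (- 2 * pi * r * S) * (S / (2 * r)) = pi * (C * C + S * S)"
      using r by (simp add: field_simps)
    then show ?thesis
      by (simp only: P_def area_form_matrix CS mult_1_right)
  qed
  define s where "s = r * C"
  define t where "t = r * S"
  have x: "disc_coords y = (s, t)"
    by (simp add: disc_coords_def y s_def t_def r_def C_def S_def)
  have s: "s \<in> {-1<..<1}"
    using sum_squares_disc_coords[of q p] x y by (intro in_disc_imp_abs_less[of s t]) auto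
  define w where "w = sqrt (1 - s * s)"
  have w: "w > 0"
    using one_minus_square_pos[OF s] by (simp add: w_def)
  define Q where "Q = (\<lambda>v :: plane. (2 * w / pi * fst v + 0 * snd v,
      t * s / (2 * w ^ 3) * fst v + 1 / (2 * w) * snd v))"
  have Q: "(square_of_disc has_derivative Q) (at (s, t))"
  proof -
    have 1: "((\<lambda>x. cap_area (fst x)) has_derivative (\<lambda>v. fst v * (2 * w / pi))) (at (s, t))"
      using has_derivative_compose[OF has_derivative_fst[OF has_derivative_ident], of cap_area
          "(*) (2 * w / pi)" "(s, t)" UNIV] DERIV_cap_area[OF s]
      by (simp add: has_field_derivative_def w_def mult.commute)
    have 2: "((\<lambda>x. 1 / 2 + snd x / (2 * sqrt (1 - fst x * fst x))) has_derivative
        (\<lambda>v. t * s / (2 * w ^ 3) * fst v + 1 / (2 * w) * snd v)) (at (s, t))"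
      using w one_minus_square_pos[OF s]
      by (auto intro!: derivative_eq_intros
          simp: fun_eq_iff field_simps power3_eq_cube simp flip: w_def)
    show ?thesis
      unfolding square_of_disc_def[abs_def] Q_def
      using has_derivative_Pair[OF 1 2] by (simp add: mult.commute)
  qed
  have Q_area: "area_form (Q u) (Q v) = 1 / pi * area_form u v" for u v
    unfolding Q_def area_form_matrix using w by simp
  show ?thesis
  proof (intro exI conjI allI)
    show "(square_coords has_derivative (\<lambda>v. Q (P v))) (at y)"
      using has_derivative_compose[OF P Q[folded x]] by (simp add: square_coords_def[abs_def])
    show "area_form (Q (P v)) (Q (P w)) = area_form v w" for v w
      by (simp add: Q_area P_area)
  qed
qed

lemma Ck_on_square_coords:
  assumes "open S" "Ck_on k S f" "Ck_on k S g" "\<And>x. x \<in> S \<Longrightarrow> f x \<in> {0<..<1}"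
  shows "Ck_on k S (\<lambda>x. square_coords (f x, g x))"
proof -
  define s where "s = (\<lambda>x. sqrt (f x) * cos (2 * pi * g x))"
  define t where "t = (\<lambda>x. sqrt (f x) * sin (2 * pi * g x))"
  define w where "w = (\<lambda>x. sqrt (1 + - 1 * (s x * s x)))"
  have root: "Ck_on k S (\<lambda>x. sqrt (f x))"
    using assms by (intro Ck_on_compose_real[OF _ Ck_on_sqrt]) auto
  have angle: "Ck_on k S (\<lambda>x. 2 * pi * g x)"
    by (intro Ck_on_mult Ck_on_const assms)
  have s: "Ck_on k S s" and t: "Ck_on k S t"
    unfolding s_def t_def
    by (intro Ck_on_mult root assms(1) UNIV_I
        Ck_on_compose_real[OF assms(1) Ck_on_sin_cos[THEN conjunct1] angle]
        Ck_on_compose_real[OF assms(1) Ck_on_sin_cos[THEN conjunct2] angle])+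
  have s_less: "s x \<in> {-1<..<1}" if "x \<in> S" for x
    using sum_squares_disc_coords[of "f x" "g x"] assms(4)[OF that]
    by (intro in_disc_imp_abs_less[of "s x" "t x"]) (auto simp: disc_coords_def s_def t_def)
  have w_pos: "0 < 1 + - 1 * (s x * s x)" if "x \<in> S" for x
    using one_minus_square_pos[OF s_less[OF that]] by simp
  have w: "Ck_on k S w"
    unfolding w_def using w_pos
    by (intro Ck_on_compose_real[OF _ Ck_on_sqrt] Ck_on_add Ck_on_mult Ck_on_const s assms(1)) auto
  have "Ck_on k S (\<lambda>x. arcsin (s x))"
    by (rule Ck_on_compose_real[OF assms(1) Ck_on_arcsin s s_less])
  moreover have "Ck_on k S (\<lambda>x. inverse (w x))"
    using w_pos by (intro Ck_on_compose_real[OF _ Ck_on_inverse w]) (auto simp: w_def assms(1))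
  ultimately have "Ck_on k S (\<lambda>x. (1 / 2 + (s x * w x + arcsin (s x)) * (1 / pi),
      1 / 2 + t x * (inverse (w x) * (1 / 2))))"
    by (intro Ck_on_Pair Ck_on_add Ck_on_mult Ck_on_const s t w assms(1))
  moreover have "square_coords (f x, g x) = (1 / 2 + (s x * w x + arcsin (s x)) * (1 / pi),
      1 / 2 + t x * (inverse (w x) * (1 / 2)))" for x
  proof -
    have "disc_coords (f x, g x) = (s x, t x)"
      by (simp add: disc_coords_def s_def t_def)
    moreover have "sqrt (1 - s x * s x) = w x"
      by (simp add: w_def)
    ultimately show ?thesis
      by (simp add: square_coords_def square_of_disc_def cap_area_def field_simps)
  qed
  ultimately show ?thesis
    by simp
qed

section \<open>Sections of the image: slit annuli in the square\<close>

text \<open>In the coordinates \<open>q, p\<close> the set is a union of full circles (those with \<open>q\<close> in \<open>J\<close>), slit along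
  the ray \<open>p = a\<close>. The whole ray, including the center at \<open>q = 0\<close> and a boundary point of the square
  at \<open>q = 1\<close>, therefore lies in the complement. Every other point of the complement is either
  outside the square, which is a path-connected region that the ray reaches, or on a circle with
  \<open>q\<close> outside \<open>J\<close>, along which it can be moved to the ray.\<close>

lemma path_connected_Compl_slit_annuli:
  assumes "J \<subseteq> {0<..<1}"
  shows "path_connected (- square_coords ` (J \<times> {a<..<a + 1}))" (is "path_connected (- ?E)")
proof -
  have E_subset: "?E \<subseteq> open_square"
    by (rule image_subsetI, rule square_coords_in_open_square) (use assms in auto)
  have join: "path_component (- ?E) x y" if "path_connected T" "T \<subseteq> - ?E" "x \<in> T" "y \<in> T" for T x y
    using path_component_of_subset[OF that(2)] that path_connected_component[of T] by blast
  let ?R = "(\<lambda>q. square_coords (q, a)) ` {0..1}"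
  have R_path: "path_connected ?R"
    by (intro path_connected_continuous_image continuous_on_square_coords_ray) simp
  have R_subset: "?R \<subseteq> - ?E"
  proof (rule image_subsetI, rule ComplI)
    fix q assume q: "q \<in> {0..1}" and "square_coords (q, a) \<in> ?E"
    then obtain q' p' where q': "q' \<in> J" and p': "p' \<in> {a<..<a + 1}"
      and eq: "square_coords (q, a) = square_coords (q', p')"
      by blast
    have J: "q' \<in> {0<..<1}"
      using q' assms by blast
    have "q \<noteq> 1"
      using square_coords_1[of a] square_coords_in_open_square[of "(q', p')"] J eq by auto
    then have "q' = q"
      using square_coords_eqD_disc(2)[OF eq] q J by simp
    then obtain k :: int where "p' = a + k"
      using square_coords_eqD[OF eq] J by blast
    then have "0 < k" "k < 1"
      using p' by simp_all
    then show False
      by linarith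
  qed
  have center: "(1 / 2, 1 / 2) \<in> ?R"
    by (rule image_eqI[where x = 0]) (simp_all add: square_coords_0)
  have to_center: "path_component (- ?E) x (1 / 2, 1 / 2)" if x: "x \<in> - ?E" for x
  proof (cases "x \<in> open_square")
    case False
    have "path_connected (- open_square)"
      by (intro path_connected_complement_bounded_convex bounded_Times convex_Times) simp_all
    moreover have "- open_square \<subseteq> - ?E"
      using E_subset by (simp only: Compl_subset_Compl_iff)
    ultimately have "path_component (- ?E) x (square_coords (1, a))"
      by (rule join) (use False square_coords_1 in \<open>simp_all only: Compl_iff not_False_eq_True\<close>)
    moreover have "path_component (- ?E) (square_coords (1, a)) (1 / 2, 1 / 2)"
      using center by (intro join[OF R_path R_subset]) auto
    ultimately show ?thesis
      by (rule path_component_trans)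
  next
    case True
    then show ?thesis
    proof (cases rule: open_square_cases)
      case 1
      then show ?thesis
        using x by (simp add: path_component_refl)
    next
      case (2 q p)
      define p' where "p' = p + of_int (- \<lfloor>p - a\<rfloor>)"
      have x_eq: "x = square_coords (q, p')"
        unfolding p'_def square_coords_periodic by (rule 2)
      have p': "a \<le> p'" "p' < a + 1"
        unfolding p'_def by linarith+
      have ray: "square_coords (q, a) \<in> ?R"
        using 2 by auto
      show ?thesis
      proof (cases "q \<in> J")
        case True
        then have "p' = a"
          using x x_eq p' by fastforce
        then show ?thesis
          using x_eq ray center by (intro join[OF R_path R_subset]) auto
      next
        case False
        let ?C = "range (\<lambda>p. square_coords (q, p))"
        have "Ck_on 0 UNIV (\<lambda>p. square_coords (q, p))"
          using 2 by (intro Ck_on_square_coords Ck_on_const Ck_on_bounded_linear bounded_linear_ident) auto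
        then have "path_connected ?C"
          by (intro path_connected_continuous_image) auto
        moreover have "?C \<subseteq> - ?E"
        proof (rule image_subsetI, rule ComplI)
          fix p assume "square_coords (q, p) \<in> ?E"
          then obtain q' p' where "q' \<in> J" "square_coords (q, p) = square_coords (q', p')"
            by blast
          then show False
            using square_coords_eqD[of q p q' p'] 2 assms False by blast
        qed
        ultimately have "path_component (- ?E) x (square_coords (q, a))"
          using x_eq by (intro join[of ?C]) auto
        moreover have "path_component (- ?E) (square_coords (q, a)) (1 / 2, 1 / 2)"
          using ray center by (intro join[OF R_path R_subset]) auto
        ultimately show ?thesis
          by (rule path_component_trans)
      qed
    qed
  qed
  show ?thesis
    unfolding path_connected_component
    using to_center path_component_sym path_component_trans by meson
qed

text \<open>The change-of-variables theorem concerns \<open>real ^ 2\<close>; these mutually inverse maps carry it over to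
  pairs of reals.\<close>

definition plane_of_vec :: "real ^ 2 \<Rightarrow> plane" where
  "plane_of_vec x = (x $ 1, x $ 2)"

definition vec_of_plane :: "plane \<Rightarrow> real ^ 2" where
  "vec_of_plane y = vector [fst y, snd y]"

lemma plane_of_vec_inverse [simp]: "plane_of_vec (vec_of_plane y) = y"
  and vec_of_plane_inverse [simp]: "vec_of_plane (plane_of_vec x) = x"
  by (simp_all add: plane_of_vec_def vec_of_plane_def vec_eq_iff forall_2)

lemma bounded_linear_plane_of_vec: "bounded_linear plane_of_vec"
  unfolding plane_of_vec_def[abs_def] by (intro bounded_linear_Pair bounded_linear_vec_nth)

lemma bounded_linear_vec_of_plane: "bounded_linear vec_of_plane"
proof -
  have "linear vec_of_plane"
    by (rule linearI) (simp_all add: vec_of_plane_def vec_eq_iff forall_2)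
  then show ?thesis
    by (rule linear_conv_bounded_linear[THEN iffD1])
qed

lemma vimage_plane_of_vec: "plane_of_vec -` S = vec_of_plane ` S"
  by (auto intro: image_eqI[where x = "plane_of_vec x" for x])

lemma lborel_plane: "lborel = distr lborel borel plane_of_vec"
proof (rule lborel_eqI)
  fix l u :: plane
  assume lu: "\<And>b. b \<in> Basis \<Longrightarrow> l \<bullet> b \<le> u \<bullet> b"
  have le: "fst l \<le> fst u" "snd l \<le> snd u"
    using lu[of "(1, 0)"] lu[of "(0, 1)"] by (auto simp: Basis_prod_def inner_prod_def)
  have "plane_of_vec -` box l u = box (vec_of_plane l) (vec_of_plane u)"
    by (auto simp: set_eq_iff mem_box_cart forall_2 plane_of_vec_def vec_of_plane_def mem_box
        Basis_prod_def inner_prod_def)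
  moreover have "emeasure lborel (box (vec_of_plane l) (vec_of_plane u)) =
      ennreal (\<Prod>b\<in>Basis. (vec_of_plane u - vec_of_plane l) \<bullet> b)"
    using le by (intro emeasure_lborel_box)
      (auto simp: Basis_vec_def inner_axis vec_of_plane_def UNIV_2)
  moreover have "(\<Prod>b\<in>Basis. (vec_of_plane u - vec_of_plane l) \<bullet> b) = (\<Prod>b\<in>Basis. (u - l) \<bullet> b)"
    by (simp add: Basis_vec_def UNIV_2 Basis_prod_def inner_axis inner_prod_def axis_eq_axis
        vec_of_plane_def)
  moreover have "plane_of_vec \<in> borel_measurable lborel"
    using borel_measurable_continuous_onI[OF linear_continuous_on[OF bounded_linear_plane_of_vec]]
    by simp
  ultimately show "emeasure (distr lborel borel plane_of_vec) (box l u) = (\<Prod>b\<in>Basis. (u - l) \<bullet> b)"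
    by (simp add: emeasure_distr)
qed simp

lemma emeasure_lborel_plane:
  assumes "S \<in> sets borel"
  shows "emeasure lborel S = emeasure lborel (vec_of_plane ` S)"
proof -
  have "plane_of_vec \<in> borel_measurable borel"
    by (rule borel_measurable_continuous_onI[OF linear_continuous_on[OF bounded_linear_plane_of_vec]])
  then show ?thesis
    using assms by (subst lborel_plane) (simp add: emeasure_distr vimage_plane_of_vec)
qed

lemma open_vec_of_plane_image: "open S \<Longrightarrow> open (vec_of_plane ` S)"
  unfolding vimage_plane_of_vec[symmetric]
  using bounded_linear_plane_of_vec by (intro open_vimage linear_continuous_on)

text \<open>Preservation of \<open>area_form\<close> says that the Jacobian determinant is 1, so this is the change of
  variables formula for the constant function 1.\<close>

lemma emeasure_area_preserving_image:
  fixes f :: "plane \<Rightarrow> plane"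
  assumes "open S" "emeasure lborel S < \<infinity>" "inj_on f S"
    and D: "\<And>x. x \<in> S \<Longrightarrow> (f has_derivative D x) (at x)"
    and area: "\<And>x v w. x \<in> S \<Longrightarrow> area_form (D x v) (D x w) = area_form v w"
  shows "emeasure lborel (f ` S) = emeasure lborel S"
proof -
  define T where "T = vec_of_plane ` S"
  define g where "g = (\<lambda>x. vec_of_plane (f (plane_of_vec x)))"
  define g' where "g' = (\<lambda>x v. vec_of_plane (D (plane_of_vec x) (plane_of_vec v)))"
  have "continuous_on S f"
    using D has_derivative_continuous by (blast intro: continuous_at_imp_continuous_on)
  then have "open (f ` S)"
    by (rule invariance_of_domain[OF _ assms(1,3)])
  have gT: "g ` T = vec_of_plane ` f ` S"
    by (simp add: g_def T_def image_image)
  have "open T" "open (g ` T)"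
    unfolding gT unfolding T_def by (rule open_vec_of_plane_image, fact)+
  have T_emeasure: "emeasure lebesgue T = emeasure lborel S"
    using \<open>open T\<close> assms(1) by (simp add: T_def emeasure_lborel_plane)
  then have T: "T \<in> lmeasurable"
    using \<open>open T\<close> assms(2) by (intro fmeasurableI) auto
  have det: "det (matrix (g' x)) = 1" if "x \<in> T" for x
  proof -
    have x: "plane_of_vec x \<in> S"
      using that by (auto simp: T_def)
    have "det (matrix (g' x)) =
        area_form (D (plane_of_vec x) (plane_of_vec (axis 1 1))) (D (plane_of_vec x) (plane_of_vec (axis 2 1)))"
      by (simp add: det_2 matrix_def g'_def vec_of_plane_def area_form_def)
    also have "\<dots> = 1"
      by (subst area[OF x]) (simp add: area_form_def plane_of_vec_def axis_def)
    finally show ?thesis .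
  qed
  have "g ` T \<in> lmeasurable \<and> measure lebesgue (g ` T) = measure lebesgue T"
  proof (subst has_measure_differentiable_image)
    show "T \<in> sets lebesgue"
      using T by blast
    show "(g has_derivative g' x) (at x within T)" if "x \<in> T" for x
      unfolding g_def g'_def
      using that D[of "plane_of_vec x"]
      by (intro bounded_linear.has_derivative[OF bounded_linear_vec_of_plane]
          has_derivative_compose[OF bounded_linear.has_derivative[OF bounded_linear_plane_of_vec
              has_derivative_ident]])
        (auto simp: T_def)
    show "inj_on g T"
    proof (rule inj_onI)
      fix x y assume xy: "x \<in> T" "y \<in> T" and "g x = g y"
      then have "plane_of_vec (vec_of_plane (f (plane_of_vec x))) =
          plane_of_vec (vec_of_plane (f (plane_of_vec y)))"
        by (simp only: g_def)
      then have "f (plane_of_vec x) = f (plane_of_vec y)"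
        by (simp only: plane_of_vec_inverse)
      then have "plane_of_vec x = plane_of_vec y"
        by (rule inj_onD[OF assms(3)]) (use xy in \<open>auto simp: T_def\<close>)
      then have "vec_of_plane (plane_of_vec x) = vec_of_plane (plane_of_vec y)"
        by (rule arg_cong)
      then show "x = y"
        by (simp only: vec_of_plane_inverse)
    qed
    show "((\<lambda>x. \<bar>det (matrix (g' x))\<bar>) has_integral measure lebesgue T) T"
      using T integrable_on_const[OF T, of "1::real"] lmeasure_integral[OF T]
      by (subst has_integral_cong[OF arg_cong[OF det]]) (auto simp: has_integral_iff)
  qed
  then have "emeasure lebesgue (g ` T) = emeasure lebesgue T"
    using T by (simp add: emeasure_eq_measure2)
  then show ?thesis
    using \<open>open (f ` S)\<close> \<open>open (g ` T)\<close> T_emeasure by (simp add: emeasure_lborel_plane gT)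
qed

lemma inj_on_square_coords: "inj_on square_coords ({0<..<1} \<times> {a<..<a + 1})"
proof (rule inj_onI, clarify)
  fix q p q' p' assume *: "q \<in> {0<..<1}" "p \<in> {a<..<a + 1}" "q' \<in> {0<..<1}" "p' \<in> {a<..<a + 1}"
    and eq: "square_coords (q, p) = square_coords (q', p')"
  obtain k :: int where "q' = q" "p' = p + k"
    using square_coords_eqD[OF eq] * by blast
  moreover from this have "- 1 < k" "k < 1"
    using * by auto
  ultimately show "q = q' \<and> p = p'"
    by simp
qed

lemma
  assumes "0 \<le> l" "l \<le> u" "u \<le> 1"
  shows open_square_coords_rectangle: "open (square_coords ` ({l<..<u} \<times> {a<..<a + 1}))"
    and emeasure_square_coords_rectangle:
      "emeasure lborel (square_coords ` ({l<..<u} \<times> {a<..<a + 1})) = ennreal (u - l)"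
proof -
  let ?S = "{l<..<u} \<times> {a<..<a + 1}"
  have S: "y \<in> strip" if "y \<in> ?S" for y
    using that assms by auto
  have "emeasure lborel ?S = emeasure (lborel \<Otimes>\<^sub>M lborel) ?S"
    by (simp add: lborel_prod)
  also have "\<dots> = ennreal (u - l)"
    using assms by (simp add: lborel.emeasure_pair_measure_Times)
  finally have S_area: "emeasure lborel ?S = ennreal (u - l)" .
  have "\<exists>D. (square_coords has_derivative D) (at y) \<and> (\<forall>v w. area_form (D v) (D w) = area_form v w)"
    if "y \<in> ?S" for y
    using square_coords_has_derivative[OF S[OF that]] .
  then obtain D where D: "\<And>y. y \<in> ?S \<Longrightarrow> (square_coords has_derivative D y) (at y)"
    "\<And>y v w. y \<in> ?S \<Longrightarrow> area_form (D y v) (D y w) = area_form v w"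
    by metis
  have inj: "inj_on square_coords ?S"
    using inj_on_square_coords by (rule inj_on_subset) (use assms in auto)
  then have "emeasure lborel (square_coords ` ?S) = emeasure lborel ?S"
    using S_area by (intro emeasure_area_preserving_image[OF open_Times _ _ D]) auto
  then show "emeasure lborel (square_coords ` ?S) = ennreal (u - l)"
    by (simp only: S_area)
  have "continuous_on ?S square_coords"
    using D(1) has_derivative_continuous by (blast intro: continuous_at_imp_continuous_on)
  then show "open (square_coords ` ?S)"
    by (rule invariance_of_domain[OF _ open_Times inj]) simp_all
qed

text \<open>The values of \<open>q\<^sup>1\<close> that occur in the cube once \<open>p\<^sub>n + c * q\<^sup>1\<close> is known to be \<open>r\<close> modulo \<open>c\<close>.\<close>

definition wrapped_interval :: "real \<Rightarrow> real \<Rightarrow> real set" where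
  "wrapped_interval c r = {q \<in> {0<..<1}. \<exists>p\<in>{0<..<1}. \<exists>k::int. p + c * q = r + c * k}"

text \<open>Dividing the congruence by \<open>c\<close> shows that \<open>q\<close> lies, modulo 1, in an interval of length \<open>1 / c\<close>.
  Inside the unit interval this leaves at most two pieces, of total length \<open>1 / c\<close>: the second one
  is what the first one loses by being cut off at 1.\<close>

lemma wrapped_interval_subset:
  assumes "1 \<le> c"
  obtains b where "0 \<le> b" "b < 1"
    "wrapped_interval c r \<subseteq> {b<..<min 1 (b + 1 / c)} \<union> {0<..<max 0 (b + 1 / c - 1)}"
proof
  define b where "b = frac ((r - 1) / c)"
  show b: "0 \<le> b" "b < 1"
    by (simp_all add: b_def frac_lt_1)
  show "wrapped_interval c r \<subseteq> {b<..<min 1 (b + 1 / c)} \<union> {0<..<max 0 (b + 1 / c - 1)}"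
  proof
    fix q assume "q \<in> wrapped_interval c r"
    then obtain p k where q: "0 < q" "q < 1" and p: "0 < p" "p < 1" and eq: "p + c * q = r + c * of_int k"
      by (auto simp: wrapped_interval_def)
    define m where "m = k + \<lfloor>(r - 1) / c\<rfloor>"
    have "q = (r + c * k - p) / c"
      using assms by (simp flip: eq)
    also have "\<dots> = (r - 1) / c + k + (1 - p) / c"
      using assms by (simp add: diff_divide_distrib add_divide_distrib)
    also have "\<dots> = b + m + (1 - p) / c"
      by (simp add: b_def m_def frac_def)
    finally have q_eq: "q = b + m + (1 - p) / c" .
    have *: "0 < (1 - p) / c" "(1 - p) / c < 1 / c" "1 / c \<le> 1"
      using p assms by (simp_all add: divide_strict_right_mono)
    \<comment> \<open>Only the translates by 0 and by -1 of the interval starting at \<open>b\<close> meet the unit interval.\<close>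
    have "m < 1" "m > - 2"
      using q_eq * b q by linarith+
    then have "m = 0 \<or> m = - 1"
      by linarith
    then show "q \<in> {b<..<min 1 (b + 1 / c)} \<union> {0<..<max 0 (b + 1 / c - 1)}"
      using q_eq * q by auto
  qed
qed

lemma emeasure_slit_annuli_le:
  assumes "1 \<le> c"
  shows "emeasure lebesgue (square_coords ` (wrapped_interval c r \<times> {a<..<a + 1})) \<le> ennreal (1 / c)"
proof -
  obtain b where b: "0 \<le> b" "b < 1"
    "wrapped_interval c r \<subseteq> {b<..<min 1 (b + 1 / c)} \<union> {0<..<max 0 (b + 1 / c - 1)}"
    using wrapped_interval_subset[OF assms] .
  have c: "0 < 1 / c" "1 / c \<le> 1"
    using assms by simp_all
  let ?I = "{a<..<a + 1}"
  let ?A = "square_coords ` ({b<..<min 1 (b + 1 / c)} \<times> ?I)"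
  let ?B = "square_coords ` ({0<..<max 0 (b + 1 / c - 1)} \<times> ?I)"
  have A: "emeasure lborel ?A = ennreal (min 1 (b + 1 / c) - b)"
    using b c by (intro emeasure_square_coords_rectangle) auto
  have "b + 1 / c \<le> 1 + 1"
    using b(2) c(2) by (intro add_mono) simp_all
  then have B: "emeasure lborel ?B = ennreal (max 0 (b + 1 / c - 1))"
    using emeasure_square_coords_rectangle[of 0 "max 0 (b + 1 / c - 1)" a] by simp
  have borel: "?A \<in> sets borel" "?B \<in> sets borel"
    using b(1,2) c \<open>b + 1 / c \<le> 1 + 1\<close> by (intro borel_open open_square_coords_rectangle; simp)+
  have "emeasure lebesgue (square_coords ` (wrapped_interval c r \<times> ?I)) \<le> emeasure lebesgue (?A \<union> ?B)"
  proof (rule emeasure_mono)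
    show "square_coords ` (wrapped_interval c r \<times> ?I) \<subseteq> ?A \<union> ?B"
      using b(3) by (simp only: image_Un[symmetric] Sigma_Un_distrib1[symmetric] image_mono Sigma_mono)
    show "?A \<union> ?B \<in> sets lebesgue"
      using borel by auto
  qed
  also have "\<dots> = emeasure lborel (?A \<union> ?B)"
    using borel by simp
  also have "\<dots> \<le> emeasure lborel ?A + emeasure lborel ?B"
    using borel by (intro emeasure_subadditive) auto
  also have "\<dots> = ennreal (min 1 (b + 1 / c) - b) + ennreal (max 0 (b + 1 / c - 1))"
    by (simp only: A B)
  also have "\<dots> = ennreal (1 / c)"
    using b(1,2) c by (subst ennreal_plus[symmetric]) (auto simp: min_def max_def simp del: ennreal_plus)
  finally show ?thesis .
qed

section \<open>The symplectic embedding\<close>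

text \<open>The analogue of \<open>square_coords\<close>, of period \<open>c\<close> in the second argument, for the rectangle of width
  1 and height \<open>c\<close>.\<close>

definition stretched_coords :: "real \<Rightarrow> plane \<Rightarrow> plane" where
  "stretched_coords c y =
    (fst (square_coords (fst y, snd y / c)), c * snd (square_coords (fst y, snd y / c)))"

text \<open>The time-one map of the linear Hamiltonian flow generated by \<open>- c * q\<^sup>1 * q\<^sup>n\<close>: it adds \<open>c * q\<^sup>n\<close>
  to \<open>p\<^sub>1\<close> and \<open>c * q\<^sup>1\<close> to \<open>p\<^sub>n\<close>.\<close>

definition shear :: "real \<Rightarrow> 'm::{finite,linorder} phase_space \<Rightarrow> 'm phase_space" where
  "shear c x = (let m = Max UNIV; y = fst x; z = snd x in
    ((fst y, snd y + c * fst (z $ m)),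
     \<chi> i. if i = m then (fst (z $ m), snd (z $ m) + c * fst y) else z $ i))"

text \<open>The sheared momenta \<open>p\<^sub>1\<close> and \<open>p\<^sub>n\<close> are read as angles, of period 1 and \<open>c\<close>.\<close>

definition wrap :: "real \<Rightarrow> 'm::{finite,linorder} phase_space \<Rightarrow> 'm phase_space" where
  "wrap c x = (square_coords (fst x),
     \<chi> i. if i = Max UNIV then stretched_coords c (snd x $ i) else snd x $ i)"

definition cube_embedding :: "real \<Rightarrow> 'm::{finite,linorder} phase_space \<Rightarrow> 'm phase_space" where
  "cube_embedding c x = wrap c (shear c x)"

lemma fst_cube_embedding:
  "fst (cube_embedding c (y, z)) = square_coords (fst y, snd y + c * fst (z $ Max UNIV))"
  and snd_cube_embedding:
  "snd (cube_embedding c (y, z)) $ i = (if i = Max UNIV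
     then stretched_coords c (fst (z $ i), snd (z $ i) + c * fst y) else z $ i)"
  by (simp_all add: cube_embedding_def wrap_def shear_def Let_def)

lemma stretched_coords_eqD:
  assumes "stretched_coords c (q, p) = stretched_coords c (q', p')"
    and "0 < c" "q \<in> {0<..<1}" "q' \<in> {0<..<1}"
  obtains k :: int where "q' = q" "p' = p + c * k"
proof -
  have "square_coords (q, p / c) = square_coords (q', p' / c)"
    using assms(1,2) by (simp add: stretched_coords_def prod_eq_iff)
  then obtain k :: int where "q' = q" "p' / c = p / c + k"
    using square_coords_eqD assms(3,4) by blast
  then show thesis
    using that[of k] assms(2) by (simp add: field_simps)
qed

lemma stretched_coords_periodic:
  assumes "0 < c"
  shows "stretched_coords c (q, p + c * of_int k) = stretched_coords c (q, p)"
proof -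
  have "(p + c * of_int k) / c = p / c + of_int k"
    using assms by (simp add: field_simps)
  then show ?thesis
    by (simp add: stretched_coords_def square_coords_periodic)
qed

lemma stretched_coords_has_derivative:
  assumes "y \<in> strip" "0 < c"
  shows "\<exists>D. (stretched_coords c has_derivative D) (at y) \<and> (\<forall>v w. area_form (D v) (D w) = area_form v w)"
proof -
  obtain D where D: "(square_coords has_derivative D) (at (fst y, snd y / c))"
    "\<And>v w. area_form (D v) (D w) = area_form v w"
    using square_coords_has_derivative[of "(fst y, snd y / c)"] assms(1)
    by (auto simp del: split_paired_All)
  define L :: "plane \<Rightarrow> plane" where "L = (\<lambda>v. (fst v, snd v / c))"
  have "(L has_derivative L) (at y)"
    unfolding L_def using assms(2) by (auto intro!: derivative_eq_intros)
  moreover have "(square_coords has_derivative D) (at (L y))"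
    using D(1) by (simp only: L_def)
  ultimately have *: "((\<lambda>y. square_coords (L y)) has_derivative (\<lambda>v. D (L v))) (at y)"
    by (rule has_derivative_compose)
  show ?thesis
  proof (intro exI conjI allI)
    show "(stretched_coords c has_derivative (\<lambda>v. (fst (D (L v)), c * snd (D (L v))))) (at y)"
      using has_derivative_Pair[OF has_derivative_fst[OF *]
          has_derivative_mult_right[OF has_derivative_snd[OF *]]]
      by (simp add: stretched_coords_def[abs_def] L_def)
    show "area_form (fst (D (L v)), c * snd (D (L v))) (fst (D (L w)), c * snd (D (L w))) =
        area_form v w" for v w
    proof -
      have "area_form (fst (D (L v)), c * snd (D (L v))) (fst (D (L w)), c * snd (D (L w))) =
          c * area_form (D (L v)) (D (L w))"
        by (simp add: area_form_def algebra_simps)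
      also have "\<dots> = c * area_form (L v) (L w)"
        by (simp only: D(2))
      also have "\<dots> = area_form v w"
        using assms(2) by (simp add: L_def area_form_def right_diff_distrib)
      finally show ?thesis .
    qed
  qed
qed

lemma linear_shear: "linear (shear c)"
  by (rule linearI) (auto simp: shear_def Let_def vec_eq_iff prod_eq_iff algebra_simps)

text \<open>The two cross terms \<open>c * dq\<^sup>1 \<and> dq\<^sup>n\<close> and \<open>c * dq\<^sup>n \<and> dq\<^sup>1\<close> that the shear creates
  cancel.\<close>

lemma omega0_shear: "omega0 (shear c v) (shear c w) = omega0 v w"
proof -
  let ?m = "Max UNIV :: 'a"
  have split: "omega0 a b = area_form (fst a) (fst b) + area_form (snd a $ ?m) (snd b $ ?m) +
      (\<Sum>i\<in>UNIV - {?m}. area_form (snd a $ i) (snd b $ i))" for a b :: "'a phase_space"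
    by (simp add: omega0_def sum.remove[of UNIV ?m])
  have "area_form (fst (shear c v)) (fst (shear c w)) +
      area_form (snd (shear c v) $ ?m) (snd (shear c w) $ ?m) =
      area_form (fst v) (fst w) + area_form (snd v $ ?m) (snd w $ ?m)"
    by (simp add: shear_def Let_def area_form_def algebra_simps)
  moreover have "(\<Sum>i\<in>UNIV - {?m}. area_form (snd (shear c v) $ i) (snd (shear c w) $ i)) =
      (\<Sum>i\<in>UNIV - {?m}. area_form (snd v $ i) (snd w $ i))"
    by (intro sum.cong) (auto simp: shear_def Let_def)
  ultimately show ?thesis
    by (simp only: split)
qed

lemma wrap_has_derivative:
  assumes "0 < c" "fst x \<in> strip" "snd x $ Max UNIV \<in> strip"
  shows "\<exists>D. (wrap c has_derivative D) (at x) \<and> (\<forall>v w. omega0 (D v) (D w) = omega0 v w)"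
proof -
  let ?m = "Max UNIV :: 'a"
  obtain A where A: "(square_coords has_derivative A) (at (fst x))"
    "\<And>v w. area_form (A v) (A w) = area_form v w"
    using square_coords_has_derivative[OF assms(2)] by blast
  obtain B where B: "(stretched_coords c has_derivative B) (at (snd x $ ?m))"
    "\<And>v w. area_form (B v) (B w) = area_form v w"
    using stretched_coords_has_derivative[OF assms(3,1)] by blast
  have comp: "((\<lambda>x. snd x $ i) has_derivative (\<lambda>v. snd v $ i)) (at x)" for i
    by (intro bounded_linear_imp_has_derivative bounded_linear_compose[OF bounded_linear_vec_nth]
        bounded_linear_snd)
  have "((\<lambda>x. if i = ?m then stretched_coords c (snd x $ i) else snd x $ i) has_derivative
      (\<lambda>v. if i = ?m then B (snd v $ i) else snd v $ i)) (at x)" for i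
    using comp[of i] has_derivative_compose[OF comp[of ?m] B(1)] by (cases "i = ?m") simp_all
  moreover have "((\<lambda>x. square_coords (fst x)) has_derivative (\<lambda>v. A (fst v))) (at x)"
    using has_derivative_compose[OF has_derivative_fst[OF has_derivative_ident] A(1)] .
  ultimately have "(wrap c has_derivative
      (\<lambda>v. (A (fst v), \<chi> i. if i = ?m then B (snd v $ i) else snd v $ i))) (at x)"
    unfolding wrap_def[abs_def] by (intro has_derivative_Pair has_derivative_vec_lambda)
  moreover have "omega0 (A (fst v), \<chi> i. if i = ?m then B (snd v $ i) else snd v $ i)
      (A (fst w), \<chi> i. if i = ?m then B (snd w $ i) else snd w $ i) = omega0 v w" for v w :: "'a phase_space"
    by (auto simp: omega0_def A(2) B(2) intro!: sum.cong)
  ultimately show ?thesis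
    by blast
qed

lemma cube_embedding_has_derivative:
  assumes "0 < c" "x \<in> unit_cube"
  shows "\<exists>D. (cube_embedding c has_derivative D) (at x) \<and> (\<forall>v w. omega0 (D v) (D w) = omega0 v w)"
proof -
  have strip: "fst (shear c x) \<in> strip" "snd (shear c x) $ Max UNIV \<in> strip"
    using assms(2) by (auto simp: shear_def Let_def unit_cube_def mem_Times_iff)
  obtain D where D: "(wrap c has_derivative D) (at (shear c x))"
    "\<And>v w. omega0 (D v) (D w) = omega0 v w"
    using wrap_has_derivative[OF assms(1) strip] by blast
  have "(shear c has_derivative shear c) (at x)"
    by (intro bounded_linear_imp_has_derivative linear_conv_bounded_linear[THEN iffD1] linear_shear)
  from has_derivative_compose[OF this D(1)] show ?thesis
    unfolding cube_embedding_def[abs_def] by (auto simp only: D(2) omega0_shear)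
qed

text \<open>Nondegeneracy: a vector in the kernel would be \<open>omega0\<close>-orthogonal to every vector.\<close>

lemma omega0_preserving_imp_inj:
  fixes D :: "'m::finite phase_space \<Rightarrow> 'm phase_space"
  assumes "linear D" "\<And>v w. omega0 (D v) (D w) = omega0 v w"
  shows "inj D"
  unfolding linear_injective_0[OF assms(1)]
proof (intro allI impI)
  fix v assume "D v = 0"
  then have zero: "omega0 v w = 0" for w
    using assms(2)[of v w] by (simp add: omega0_def area_form_def)
  have axis: "omega0 v (0, axis i a) = area_form (snd v $ i) a" for i a
  proof -
    have "area_form (snd v $ j) (axis i a $ j) = (if j = i then area_form (snd v $ i) a else 0)" for j
      by (simp add: area_form_def axis_def)
    moreover have "area_form (fst v) 0 = 0"
      by (simp add: area_form_def)
    ultimately show ?thesis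
      by (simp add: omega0_def)
  qed
  have "snd v $ i = 0" for i
    using zero[of "(0, axis i (0, 1))"] zero[of "(0, axis i (1, 0))"]
    by (simp add: axis) (simp add: area_form_def prod_eq_iff)
  moreover have "fst v = 0"
    using zero[of "((0, 1), 0)"] zero[of "((1, 0), 0)"] by (simp add: omega0_def area_form_def prod_eq_iff)
  ultimately show "v = 0"
    by (simp add: prod_eq_iff vec_eq_iff)
qed

lemma open_box_product:
  fixes U :: "plane set" and V :: "'m::finite \<Rightarrow> plane set"
  assumes "open U" "\<And>i. open (V i)"
  shows "open {(y, z). y \<in> U \<and> (\<forall>i. z $ i \<in> V i)}"
proof -
  have "{(y, z). y \<in> U \<and> (\<forall>i. z $ i \<in> V i)} = U \<times> (\<Inter>i. (\<lambda>z. z $ i) -` V i)"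
    by auto
  then show ?thesis
    using assms by (simp add: open_Times open_INT open_vimage_vec_nth)
qed

lemma open_unit_cube: "open unit_cube" and open_stretched_cube: "open (stretched_cube c)"
  unfolding unit_cube_def stretched_cube_def by (intro open_box_product open_Times; simp)+

lemma Ck_on_cube_embedding: "Ck_on k unit_cube (cube_embedding c)"
proof -
  let ?m = "Max UNIV :: 'a"
  have lin: "bounded_linear (\<lambda>x :: 'a phase_space. fst (fst x))"
    "bounded_linear (\<lambda>x :: 'a phase_space. snd (fst x))"
    "bounded_linear (\<lambda>x :: 'a phase_space. fst (snd x $ i))"
    "bounded_linear (\<lambda>x :: 'a phase_space. snd (snd x $ i))"
    "bounded_linear (\<lambda>x :: 'a phase_space. snd x $ i)" for i
    by (intro bounded_linear_compose[OF bounded_linear_fst] bounded_linear_compose[OF bounded_linear_snd]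
        bounded_linear_compose[OF bounded_linear_vec_nth] bounded_linear_fst bounded_linear_snd)+
  note coord = lin[THEN Ck_on_bounded_linear[OF open_unit_cube]]
  have *: "Ck_on k unit_cube (\<lambda>x :: 'a phase_space.
      square_coords (fst (fst x), snd (fst x) + c * fst (snd x $ ?m)))"
    by (intro Ck_on_square_coords Ck_on_add Ck_on_mult Ck_on_const coord open_unit_cube)
      (auto simp: unit_cube_def)
  have st: "Ck_on k unit_cube (\<lambda>x :: 'a phase_space.
      square_coords (fst (snd x $ ?m), (snd (snd x $ ?m) + c * fst (fst x)) * (1 / c)))"
    by (intro Ck_on_square_coords Ck_on_add Ck_on_mult Ck_on_const coord open_unit_cube)
      (auto simp: unit_cube_def mem_Times_iff)
  have "Ck_on k unit_cube (\<lambda>x :: 'a phase_space.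
      stretched_coords c (fst (snd x $ ?m), snd (snd x $ ?m) + c * fst (fst x)))"
    unfolding stretched_coords_def
    using Ck_on_linear_compose[OF open_unit_cube bounded_linear_fst st]
      Ck_on_linear_compose[OF open_unit_cube bounded_linear_snd st]
    by (auto intro!: Ck_on_Pair Ck_on_mult Ck_on_const open_unit_cube)
  then have "Ck_on k unit_cube (\<lambda>x :: 'a phase_space. if i = ?m
      then stretched_coords c (fst (snd x $ i), snd (snd x $ i) + c * fst (fst x)) else snd x $ i)" for i
    using coord(5)[of k i] by (cases "i = ?m") simp_all
  then have "Ck_on k unit_cube (\<lambda>x :: 'a phase_space.
      (square_coords (fst (fst x), snd (fst x) + c * fst (snd x $ ?m)),
      \<chi> i. if i = ?m then stretched_coords c (fst (snd x $ i), snd (snd x $ i) + c * fst (fst x))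
        else snd x $ i))"
    using * by (intro Ck_on_Pair Ck_on_vec_lambda open_unit_cube)
  moreover have "cube_embedding c = (\<lambda>x :: 'a phase_space.
      (square_coords (fst (fst x), snd (fst x) + c * fst (snd x $ ?m)),
      \<chi> i. if i = ?m then stretched_coords c (fst (snd x $ i), snd (snd x $ i) + c * fst (fst x))
        else snd x $ i))"
    by (auto simp: fun_eq_iff prod_eq_iff vec_eq_iff fst_cube_embedding snd_cube_embedding)
  ultimately show ?thesis
    by simp
qed

text \<open>Although \<open>wrap\<close> is periodic, it is injective on the sheared cube: the shears depend only on
  \<open>q\<^sup>1\<close> and \<open>q\<^sup>n\<close>, which \<open>wrap\<close> determines, and the remaining ambiguity of \<open>p\<^sub>1\<close> and \<open>p\<^sub>n\<close>
  is a multiple of 1 and of \<open>c\<close>. As both lie in the unit interval and \<open>c \<ge> 1\<close>, it is zero.\<close>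

lemma inj_on_cube_embedding:
  assumes "1 \<le> c"
  shows "inj_on (cube_embedding c) (unit_cube :: 'm::{finite,linorder} phase_space set)"
proof (rule inj_onI, clarify)
  fix y y' :: plane and z z' :: "'m rest_space"
  let ?m = "Max UNIV :: 'm"
  have "0 < c"
    using assms by simp
  assume x: "(y, z) \<in> unit_cube" and x': "(y', z') \<in> unit_cube"
    and eq: "cube_embedding c (y, z) = cube_embedding c (y', z')"
  have range: "fst y \<in> {0<..<1}" "snd y \<in> {0<..<1}" "fst y' \<in> {0<..<1}" "snd y' \<in> {0<..<1}"
    "fst (z $ i) \<in> {0<..<1}" "snd (z $ i) \<in> {0<..<1}" "fst (z' $ i) \<in> {0<..<1}" "snd (z' $ i) \<in> {0<..<1}" for i
    using x x' by (auto simp: unit_cube_def mem_Times_iff)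
  have rest: "z' $ i = z $ i" if "i \<noteq> ?m" for i
    using that arg_cong[OF eq, of "\<lambda>x. snd x $ i"] by (simp add: snd_cube_embedding)
  have "square_coords (fst y, snd y + c * fst (z $ ?m)) =
      square_coords (fst y', snd y' + c * fst (z' $ ?m))"
    using arg_cong[OF eq, of fst] by (simp add: fst_cube_embedding)
  then obtain k :: int where k: "fst y' = fst y"
      "snd y' + c * fst (z' $ ?m) = snd y + c * fst (z $ ?m) + k"
    using square_coords_eqD range by blast
  have "stretched_coords c (fst (z $ ?m), snd (z $ ?m) + c * fst y) =
      stretched_coords c (fst (z' $ ?m), snd (z' $ ?m) + c * fst y')"
    using arg_cong[OF eq, of "\<lambda>x. snd x $ ?m"] by (simp add: snd_cube_embedding)
  then obtain l :: int where l: "fst (z' $ ?m) = fst (z $ ?m)"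
      "snd (z' $ ?m) + c * fst y' = snd (z $ ?m) + c * fst y + c * l"
    using stretched_coords_eqD \<open>0 < c\<close> range(5,7) by blast
  have "snd y' = snd y + k"
    using k l by simp
  moreover from this have "- 1 < k" "k < 1"
    using range(2,4) by auto
  ultimately have "y' = y"
    using k(1) by (simp add: prod_eq_iff)
  have l_eq: "snd (z' $ ?m) = snd (z $ ?m) + c * l"
    using k l by simp
  have "l = 0"
  proof (rule ccontr)
    assume "l \<noteq> 0"
    then have "1 \<le> \<bar>real_of_int l\<bar>"
      by linarith
    then have "1 * 1 \<le> c * \<bar>real_of_int l\<bar>"
      using assms by (intro mult_mono) auto
    then have "1 \<le> \<bar>c * l\<bar>"
      using assms by (simp add: abs_mult)
    then show False
      using l_eq range(6,8)[of ?m] by auto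
  qed
  then have "z' $ ?m = z $ ?m"
    using l_eq l(1) by (simp add: prod_eq_iff)
  then have "z' = z"
    using rest by (metis vec_eq_iff)
  with \<open>y' = y\<close> show "y = y' \<and> z = z'"
    by simp
qed

lemma symplectic_embedding_cube_embedding:
  assumes "1 \<le> c"
  shows "symplectic_embedding unit_cube (stretched_cube c) (cube_embedding c)"
proof -
  have "0 < c"
    using assms by simp
  have derivative: "linear (frechet_derivative (cube_embedding c) (at x)) \<and>
      (\<forall>v w. omega0 (frechet_derivative (cube_embedding c) (at x) v)
        (frechet_derivative (cube_embedding c) (at x) w) = omega0 v w)"
    if x: "x \<in> unit_cube" for x :: "'a phase_space"
  proof -
    obtain D where D: "(cube_embedding c has_derivative D) (at x)"
      "\<And>v w. omega0 (D v) (D w) = omega0 v w"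
      using cube_embedding_has_derivative[OF \<open>0 < c\<close> x] by blast
    then show ?thesis
      using frechet_derivative_at[OF D(1)] has_derivative_linear by metis
  qed
  have "cube_embedding c x \<in> stretched_cube c" if "x \<in> unit_cube" for x :: "'a phase_space"
  proof -
    obtain y z where x: "x = (y, z)"
      by (cases x)
    have yz: "y \<in> open_square" "z $ i \<in> open_square" for i
      using that by (auto simp: unit_cube_def x)
    have "square_coords (fst y, snd y + c * fst (z $ Max UNIV)) \<in> open_square"
      using yz by (intro square_coords_in_open_square) auto
    moreover have "square_coords (fst (z $ i), (snd (z $ i) + c * fst y) / c) \<in> open_square" for i
      using yz(2)[of i] by (intro square_coords_in_open_square) auto
    then have "stretched_coords c (fst (z $ i), snd (z $ i) + c * fst y) \<in> {0<..<1} \<times> {0<..<c}" for i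
      using \<open>0 < c\<close> by (auto simp: stretched_coords_def mem_Times_iff)
    ultimately show ?thesis
      using yz(2) fst_cube_embedding[of c y z] snd_cube_embedding[of c y z]
      unfolding stretched_cube_def x case_prod_beta by auto
  qed
  moreover have "\<exists>g. homeomorphism unit_cube (cube_embedding c ` unit_cube)
      (cube_embedding c :: 'a phase_space \<Rightarrow> _) g"
    using invariance_of_domain_homeomorphism[OF open_unit_cube
        Ck_on_imp_continuous_on[OF Ck_on_cube_embedding] order_refl inj_on_cube_embedding[OF assms]]
    by blast
  ultimately show ?thesis
    unfolding symplectic_embedding_def smooth_embedding_def smooth_on_def
    using derivative by (auto simp: open_unit_cube open_stretched_cube Ck_on_cube_embedding
        simp del: split_paired_All intro!: omega0_preserving_imp_inj)
qed

text \<open>Fixing \<open>z\<close> fixes \<open>q\<^sup>n = Q\<close> and the class \<open>r\<close> of \<open>p\<^sub>n + c * q\<^sup>1\<close> modulo \<open>c\<close>. The former slits the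
  annulus at the angle \<open>a = c * Q\<close>, as \<open>p\<^sub>1\<close> is never 0; the latter confines \<open>q\<^sup>1\<close> to a wrapped interval.\<close>

lemma section_cube_embedding:
  assumes "1 \<le> c"
  obtains "iota z -` (cube_embedding c ` unit_cube) = {}"
  | r a where "iota z -` (cube_embedding c ` unit_cube) =
      square_coords ` (wrapped_interval c r \<times> {a<..<a + 1})"
proof (cases "iota z -` (cube_embedding c ` unit_cube) = {}")
  case True
  then show thesis
    by (rule that(1))
next
  case False
  let ?m = "Max UNIV"
  have "0 < c"
    using assms by simp
  obtain y0 z0 where x0: "(y0, z0) \<in> unit_cube" and z: "z = snd (cube_embedding c (y0, z0))"
    using False by (auto simp: iota_def) (metis snd_conv)
  define Q where "Q = fst (z0 $ ?m)"
  define r where "r = snd (z0 $ ?m) + c * fst y0"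
  have z_m: "z $ ?m = stretched_coords c (Q, r)" and z_i: "\<And>i. i \<noteq> ?m \<Longrightarrow> z $ i = z0 $ i"
    by (simp_all add: z snd_cube_embedding Q_def r_def)
  have z0: "z0 $ i \<in> open_square" for i
    using x0 by (auto simp: unit_cube_def)
  then have Q: "Q \<in> {0<..<1}"
    unfolding Q_def by (metis mem_Times_iff)
  have "iota z -` (cube_embedding c ` unit_cube) =
      square_coords ` (wrapped_interval c r \<times> {c * Q<..<c * Q + 1})" (is "?L = ?R")
  proof (intro subset_antisym subsetI)
    fix y assume "y \<in> ?L"
    then obtain y' z' where x': "(y', z') \<in> unit_cube" and eq: "cube_embedding c (y', z') = (y, z)"
      by (auto simp: iota_def)
    have range: "fst y' \<in> {0<..<1}" "snd y' \<in> {0<..<1}"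
      "fst (z' $ ?m) \<in> {0<..<1}" "snd (z' $ ?m) \<in> {0<..<1}"
      using x' by (auto simp: unit_cube_def mem_Times_iff)
    have "stretched_coords c (Q, r) = stretched_coords c (fst (z' $ ?m), snd (z' $ ?m) + c * fst y')"
      using snd_cube_embedding[of c y' z' ?m] by (simp add: eq z_m)
    then obtain k :: int where k: "fst (z' $ ?m) = Q" "snd (z' $ ?m) + c * fst y' = r + c * k"
      using stretched_coords_eqD \<open>0 < c\<close> Q range(3) by blast
    then have "fst y' \<in> wrapped_interval c r"
      using range unfolding wrapped_interval_def by blast
    moreover have "y = square_coords (fst y', snd y' + c * Q)"
      using fst_cube_embedding[of c y' z'] by (simp add: eq k)
    ultimately show "y \<in> ?R"
      using range(2) by (intro image_eqI[where x = "(fst y', snd y' + c * Q)"]) auto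
  next
    fix y assume "y \<in> ?R"
    then obtain q s where q: "q \<in> wrapped_interval c r" and s: "s \<in> {c * Q<..<c * Q + 1}"
      and y: "y = square_coords (q, s)"
      by blast
    obtain p k where p: "p \<in> {0<..<1}" "p + c * q = r + c * of_int k" and q': "q \<in> {0<..<1}"
      using q unfolding wrapped_interval_def by blast
    define z' where "z' = (\<chi> i. if i = ?m then (Q, p) else z0 $ i)"
    have "((q, s - c * Q), z') \<in> unit_cube"
      using q' s p(1) z0 Q by (auto simp: unit_cube_def z'_def)
    moreover have "cube_embedding c ((q, s - c * Q), z') = (y, z)"
      using z_i stretched_coords_periodic[OF \<open>0 < c\<close>, of Q r k]
      by (auto simp: prod_eq_iff[of "cube_embedding c _"] vec_eq_iff fst_cube_embedding
          snd_cube_embedding z'_def p(2) y z_m)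
    ultimately show "y \<in> ?L"
      unfolding iota_def by (metis image_eqI vimageI)
  qed
  then show thesis
    by (rule that(2))
qed

theorem theorem4:
  fixes c :: real
  assumes "1 \<le> c"
  shows "\<exists>\<phi> :: 'm::{finite,linorder} phase_space \<Rightarrow> 'm phase_space.
    symplectic_embedding unit_cube (stretched_cube c) \<phi> \<and>
    (\<forall>z :: 'm rest_space.
      emeasure lebesgue (iota z -` (\<phi> ` unit_cube)) \<le> ennreal (1 / c) \<and>
      path_connected (- (iota z -` (\<phi> ` unit_cube))))"
proof (intro exI conjI allI)
  show "symplectic_embedding unit_cube (stretched_cube c) (cube_embedding c)"
    using assms by (rule symplectic_embedding_cube_embedding)
  fix z :: "'m rest_space"
  show "emeasure lebesgue (iota z -` (cube_embedding c ` unit_cube)) \<le> ennreal (1 / c)"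
    using assms by (cases rule: section_cube_embedding[of c z])
      (simp_all add: emeasure_slit_annuli_le[OF assms])
  have "wrapped_interval c r \<subseteq> {0<..<1}" for r
    by (auto simp: wrapped_interval_def)
  then have "path_connected (- square_coords ` (wrapped_interval c r \<times> {a<..<a + 1}))" for r a
    by (rule path_connected_Compl_slit_annuli)
  with assms show "path_connected (- (iota z -` (cube_embedding c ` unit_cube)))"
    by (cases rule: section_cube_embedding[of c z]) simp_all
qed

end
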